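(* Let $L\subset\mathbb{PF}^{\infty}_{\mathbb{Q}}$ be a line joining two distinct points $P_1,P_2\in\mathbb{PF}^{\infty}_{\mathbb{Q}_{\ge0}}\subset\mathbb{PF}^{\infty}_{\mathbb{Q}}$. Then $L$ is a doubly multiplicatively closed line if and only if there exist two points $Q_1=[q_1],Q_2=[q_2]\in L\cap\mathbb{PF}^{\infty}_{\mathbb{Q}_{\ge0}}$ with positive integers $$q_1=p_1^{a_1}p_2^{a_2}\cdots p_r^{a_r},\qquad q_2=p_1^{b_1}p_2^{b_2}\cdots p_r^{b_r}$$ ($p_1,\dots,p_r$ distinct primes, $a_i,b_i\ge0$ integers) having the following properties: (1) (Trivial Index Property) the gcd of the $2\times2$ minors of the matrix $\begin{pmatrix}a_1&a_2&\cdots&a_r\\ b_1&b_2&\cdots&b_r\end{pmatrix}$ is one; (2) (Monoid Addition Property) there exist two subscripts $i,j$ such that $a_ib_i=0=a_jb_j$ and either $a_ib_j\ne0$ or $a_jb_i\ne0$. In particular, if there exist two points $Q_1,Q_2\in L\cap\mathbb{PF}^{\infty}_{\mathbb{Q}_{\ge0}}$ whose corresponding integer representatives are relatively prime, then $L$ is a doubly multiplicatively closed line.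
   Context: $\mathbb{PF}^{\infty}_{\mathbb{Q}}$ is the projective space of the $\mathbb{Q}$-vector space $\bigoplus_{i\ge1}\mathbb{Q}$ (nonzero finitely supported rational sequences modulo multiplication by nonzero rationals). $\mathbb{PF}^{\infty}_{\mathbb{Q}_{\ge0}}\subset\mathbb{PF}^{\infty}_{\mathbb{Q}}$ is the subset of points having a representative with all coordinates non-negative. Coordinates are indexed by the primes in increasing order. For an integer $g>1$, $[g]\in\mathbb{PF}^{\infty}_{\mathbb{Q}_{\ge0}}$ denotes the class of its vector of prime exponents; $g$ is then called an integer representative of the point $[g]$. The line joining two distinct points is the set of points of $\mathbb{PF}^{\infty}_{\mathbb{Q}}$ represented by nonzero vectors of the 2-dimensional $\mathbb{Q}$-subspace spanned by representatives of the two points. A line $L$ joining two distinct points of $\mathbb{PF}^{\infty}_{\mathbb{Q}_{\ge0}}$ is a doubly multiplicatively closed line if the set of all integers associated to points on $L$, i.e. $\{1\}\cup\{g\in\mathbb{N}: g>1,\ [g]\in L\}$, is a doubly generated multiplicatively closed set, i.e. equals $\{u^iv^j\mid i,j\in\mathbb{N}\cup\{0\}\}$ for some integers $u,v>1$. *)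

theory Defs
  imports
    Complex_Main
    "HOL-Computational_Algebra.Primes"
    "HOL-Library.Poly_Mapping"
    "HOL-Library.Infinite_Set"
begin

text \<open>
  The rational vector space of finitely supported rational sequences is the type
  \<^typ>\<open>nat \<Rightarrow>\<^sub>0 rat\<close>, with coordinates counted from 0 instead of 1.
\<close>

definition fscale :: "rat \<Rightarrow> (nat \<Rightarrow>\<^sub>0 rat) \<Rightarrow> (nat \<Rightarrow>\<^sub>0 rat)" where
  "fscale c v = Poly_Mapping.map ((*) c) v"

lemma lookup_fscale [simp]: "Poly_Mapping.lookup (fscale c v) i = c * Poly_Mapping.lookup v i"
  by (simp add: fscale_def Poly_Mapping.map.rep_eq when_def)

interpretation finseq: vector_space fscale
  by unfold_locales (auto intro!: poly_mapping_eqI simp: Poly_Mapping.lookup_add algebra_simps)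

definition proj_rel :: "((nat \<Rightarrow>\<^sub>0 rat) \<times> (nat \<Rightarrow>\<^sub>0 rat)) set" where
  "proj_rel = {(v, w). v \<noteq> 0 \<and> w \<noteq> 0 \<and> (\<exists>c. c \<noteq> 0 \<and> w = fscale c v)}"

lemma equiv_proj_rel: "equiv {v. v \<noteq> 0} proj_rel"
proof (rule equivI)
  show "proj_rel \<subseteq> {v. v \<noteq> 0} \<times> {v. v \<noteq> 0}"
    by (auto simp: proj_rel_def)
  show "refl_on {v. v \<noteq> 0} proj_rel"
    by (auto simp: refl_on_def proj_rel_def intro!: exI[of _ 1])
  show "sym proj_rel"
  proof (rule symI)
    fix v w assume "(v, w) \<in> proj_rel"
    then obtain c where "v \<noteq> 0" "w \<noteq> 0" "c \<noteq> 0" "w = fscale c v"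
      by (auto simp: proj_rel_def)
    then show "(w, v) \<in> proj_rel"
      by (auto simp: proj_rel_def intro!: exI[of _ "inverse c"])
  qed
  show "trans proj_rel"
  proof (rule transI)
    fix u v w assume "(u, v) \<in> proj_rel" "(v, w) \<in> proj_rel"
    then obtain c d where "u \<noteq> 0" "w \<noteq> 0" "c \<noteq> 0" "d \<noteq> 0" "v = fscale c u" "w = fscale d v"
      by (auto simp: proj_rel_def)
    then show "(u, w) \<in> proj_rel"
      by (auto simp: proj_rel_def intro!: exI[of _ "d * c"])
  qed
qed

text \<open>Points of the projective space are equivalence classes, i.e. sets of nonzero vectors.\<close>

definition PF :: "(nat \<Rightarrow>\<^sub>0 rat) set set" where
  "PF = {v. v \<noteq> 0} // proj_rel"

definition PF_nonneg :: "(nat \<Rightarrow>\<^sub>0 rat) set set" where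
  "PF_nonneg = {P \<in> PF. \<exists>v\<in>P. \<forall>i. 0 \<le> Poly_Mapping.lookup v i}"

text \<open>
  The subspace does not depend on the representatives chosen below; it is 2-dimensional,
  and the set is the line joining the two points, only if these are distinct.
\<close>

definition proj_line ::
    "(nat \<Rightarrow>\<^sub>0 rat) set \<Rightarrow> (nat \<Rightarrow>\<^sub>0 rat) set \<Rightarrow> (nat \<Rightarrow>\<^sub>0 rat) set set" where
  "proj_line P Q = {R \<in> PF. \<exists>v\<in>P. \<exists>w\<in>Q. \<exists>x\<in>R. x \<in> finseq.span {v, w}}"

definition nth_prime :: "nat \<Rightarrow> nat" where
  "nth_prime = enumerate {p. prime p}"

lemma prime_nth_prime: "prime (nth_prime i)"
  using enumerate_in_set[OF primes_infinite] by (auto simp: nth_prime_def)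

lemma inj_nth_prime: "inj nth_prime"
  unfolding nth_prime_def
  by (rule strict_mono_imp_inj_on, rule strict_mono_enumerate, rule primes_infinite)

lift_definition exponents :: "nat \<Rightarrow> (nat \<Rightarrow>\<^sub>0 rat)"
  is "\<lambda>g i. of_nat (multiplicity (nth_prime i) g)"
proof -
  fix g :: nat
  show "finite {i. (of_nat (multiplicity (nth_prime i) g) :: rat) \<noteq> 0}"
  proof (cases "g = 0")
    case False
    have "{i. (of_nat (multiplicity (nth_prime i) g) :: rat) \<noteq> 0} \<subseteq> nth_prime -` {d. d dvd g}"
      using not_dvd_imp_multiplicity_0 by fastforce
    moreover have "finite (nth_prime -` {d. d dvd g})"
      using False by (intro finite_vimageI inj_nth_prime) simp
    ultimately show ?thesis
      by (rule finite_subset)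
  qed simp
qed

text \<open>Meaningful for \<open>g > 1\<close> only, where the exponent vector is nonzero.\<close>

definition int_point :: "nat \<Rightarrow> (nat \<Rightarrow>\<^sub>0 rat) set" where
  "int_point g = proj_rel `` {exponents g}"

definition assoc_integers :: "(nat \<Rightarrow>\<^sub>0 rat) set set \<Rightarrow> nat set" where
  "assoc_integers L = {1} \<union> {g. g > 1 \<and> int_point g \<in> L}"

definition doubly_generated :: "nat set \<Rightarrow> bool" where
  "doubly_generated S \<longleftrightarrow> (\<exists>u v. u > 1 \<and> v > 1 \<and> S = {u ^ i * v ^ j | i j. True})"

definition doubly_mult_closed_line :: "(nat \<Rightarrow>\<^sub>0 rat) set set \<Rightarrow> bool" where
  "doubly_mult_closed_line L \<longleftrightarrow>
     (\<exists>P\<in>PF_nonneg. \<exists>Q\<in>PF_nonneg. P \<noteq> Q \<and> L = proj_line P Q) \<and>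
     doubly_generated (assoc_integers L)"

text \<open>
  In the next two definitions the rows of the matrix are \<open>a\<close> and \<open>b\<close>, restricted to the
  indices from 1 to \<open>r\<close>. For \<open>r < 2\<close> there are no minors and the gcd is 0.
\<close>

definition trivial_index_property :: "nat \<Rightarrow> (nat \<Rightarrow> nat) \<Rightarrow> (nat \<Rightarrow> nat) \<Rightarrow> bool" where
  "trivial_index_property r a b \<longleftrightarrow>
     Gcd {int (a i) * int (b j) - int (a j) * int (b i) | i j. 1 \<le> i \<and> i < j \<and> j \<le> r} = 1"

definition monoid_addition_property :: "nat \<Rightarrow> (nat \<Rightarrow> nat) \<Rightarrow> (nat \<Rightarrow> nat) \<Rightarrow> bool" where
  "monoid_addition_property r a b \<longleftrightarrow>
     (\<exists>i\<in>{1..r}. \<exists>j\<in>{1..r}. a i * b i = 0 \<and> a j * b j = 0 \<and>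
        (a i * b j \<noteq> 0 \<or> a j * b i \<noteq> 0))"

end

theory Submission
  imports Defs "HOL-Computational_Algebra.Nth_Powers"
begin

text \<open>
  Let \<open>a\<close> and \<open>b\<close> be the exponent vectors of two integers \<open>u, v > 1\<close> on \<open>L\<close>. The integers on \<open>L\<close> are
  exactly the products \<open>u\<^sup>i v\<^sup>j\<close> iff every rational combination of \<open>a\<close> and \<open>b\<close> with natural
  entries has natural coefficients; the latter condition already forces linear independence. It
  splits into integrality of the coefficients, which is governed by the minors (Cramer's rule),
  and non-negativity, which can be read off at one coordinate where only \<open>a\<close> is nonzero and one
  where only \<open>b\<close> is. Coprime \<open>q\<^sub>1\<close> and \<open>q\<^sub>2\<close> need not satisfy the index condition, but the
  integers of which they are maximal powers satisfy the condition on combinations.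
\<close>

section \<open>Rational combinations of two rows with natural entries\<close>

text \<open>The index set is a parameter because the condition is used both for the columns
  \<open>{1..r}\<close> of the matrix and for the set of all primes.\<close>

definition monoid_basis_on :: "'k set \<Rightarrow> ('k \<Rightarrow> nat) \<Rightarrow> ('k \<Rightarrow> nat) \<Rightarrow> bool" where
  "monoid_basis_on K a b \<longleftrightarrow>
     (\<forall>x y :: rat. (\<forall>k\<in>K. x * of_nat (a k) + y * of_nat (b k) \<in> \<nat>) \<longrightarrow> x \<in> \<nat> \<and> y \<in> \<nat>)"

lemma monoid_basis_onI:
  assumes "\<And>x y :: rat. (\<And>k. k \<in> K \<Longrightarrow> x * of_nat (a k) + y * of_nat (b k) \<in> \<nat>) \<Longrightarrow> x \<in> \<nat> \<and> y \<in> \<nat>"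
  shows "monoid_basis_on K a b"
  using assms unfolding monoid_basis_on_def by blast

lemma monoid_basis_onD:
  fixes x y :: rat
  assumes "monoid_basis_on K a b" "\<And>k. k \<in> K \<Longrightarrow> x * of_nat (a k) + y * of_nat (b k) \<in> \<nat>"
  shows "x \<in> \<nat>" "y \<in> \<nat>"
  using assms unfolding monoid_basis_on_def by blast+

lemma monoid_basis_on_commute:
  assumes "monoid_basis_on K a b"
  shows "monoid_basis_on K b a"
proof (rule monoid_basis_onI)
  fix x y :: rat
  assume "\<And>k. k \<in> K \<Longrightarrow> x * of_nat (b k) + y * of_nat (a k) \<in> \<nat>"
  then have "y * of_nat (a k) + x * of_nat (b k) \<in> \<nat>" if "k \<in> K" for k
    using that by (simp add: add.commute)
  from monoid_basis_onD[OF assms this] show "x \<in> \<nat> \<and> y \<in> \<nat>" by simp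
qed

text \<open>The denominator of \<open>x\<close> in lowest terms divides every element of
  \<open>D\<close>, hence their gcd, so it is 1.\<close>

lemma rat_in_Ints_if_Gcd_eq_1:
  fixes x :: rat and D :: "int set"
  assumes "Gcd D = 1" "\<And>d. d \<in> D \<Longrightarrow> x * of_int d \<in> \<int>"
  shows "x \<in> \<int>"
proof -
  obtain m n where q: "quotient_of x = (m, n)" by fastforce
  have n: "n > 0" and cop: "coprime m n" and x: "x = of_int m / of_int n"
    using quotient_of_denom_pos[OF q] quotient_of_coprime[OF q] quotient_of_div[OF q] by auto
  have "n dvd d" if d: "d \<in> D" for d
  proof -
    obtain z where "x * of_int d = of_int z" using assms(2)[OF d] by (auto elim: Ints_cases)
    then have "(of_int (m * d) :: rat) = of_int (z * n)"
      using n by (simp add: x field_simps)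
    then have "n dvd m * d" unfolding of_int_eq_iff by simp
    then show ?thesis using cop by (simp add: coprime_dvd_mult_right_iff coprime_commute)
  qed
  then have "n dvd 1" using assms(1) by (metis Gcd_greatest)
  then show ?thesis using n x by simp
qed

text \<open>The sign of \<open>x\<close> is read off a positive multiple, which is what a coordinate
  gives where the other row vanishes.\<close>

lemma rat_in_NatsI:
  fixes x c :: rat
  assumes "x \<in> \<int>" "x * c \<ge> 0" "c > 0"
  shows "x \<in> \<nat>"
  using assms by (simp add: Nats_altdef2 zero_le_mult_iff)

lemma Nats_imp_ge_0: "(x :: rat) \<in> \<nat> \<Longrightarrow> 0 \<le> x"
  by (simp add: Nats_altdef2)

lemma Nats_imp_Ints: "(x :: rat) \<in> \<nat> \<Longrightarrow> x \<in> \<int>"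
  by (simp add: Nats_altdef2)

lemma monoid_basis_on_if_index_and_addition:
  assumes idx: "trivial_index_property r a b" and add: "monoid_addition_property r a b"
  shows "monoid_basis_on {1..r} a b"
proof (rule monoid_basis_onI)
  fix x y :: rat
  assume nat: "\<And>k. k \<in> {1..r} \<Longrightarrow> x * of_nat (a k) + y * of_nat (b k) \<in> \<nat>"
  let ?D = "{int (a i) * int (b j) - int (a j) * int (b i) | i j. 1 \<le> i \<and> i < j \<and> j \<le> r}"
  have gcd: "Gcd ?D = 1" using idx by (simp add: trivial_index_property_def)
  have "x * of_int d \<in> \<int> \<and> y * of_int d \<in> \<int>" if "d \<in> ?D" for d
  proof -
    obtain i j where ij: "1 \<le> i" "i < j" "j \<le> r"
      and d: "d = int (a i) * int (b j) - int (a j) * int (b i)" using \<open>d \<in> ?D\<close> by blast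
    let ?s = "\<lambda>k. x * of_nat (a k) + y * of_nat (b k)"
    have s: "?s i \<in> \<int>" "?s j \<in> \<int>" using nat ij by (auto intro!: Nats_imp_Ints)
    \<comment> \<open>Cramer's rule for columns \<open>i\<close> and \<open>j\<close>: eliminating
      \<open>y\<close>, respectively \<open>x\<close>, leaves the other unknown times the
      minor.\<close>
    have "x * of_int d = ?s i * of_nat (b j) - ?s j * of_nat (b i)"
      "y * of_int d = ?s j * of_nat (a i) - ?s i * of_nat (a j)"
      by (simp_all add: d algebra_simps)
    then show ?thesis using s by (metis Ints_diff Ints_mult Ints_of_nat)
  qed
  then have ints: "x \<in> \<int>" "y \<in> \<int>" using rat_in_Ints_if_Gcd_eq_1[OF gcd] by blast+
  \<comment> \<open>The two alternatives of the property differ by swapping \<open>i\<close> and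
    \<open>j\<close>; after that, column \<open>i\<close> sees only \<open>x\<close> and column
    \<open>j\<close> only \<open>y\<close>.\<close>
  obtain i j where ij: "i \<in> {1..r}" "j \<in> {1..r}" "a i \<noteq> 0" "b i = 0" "b j \<noteq> 0" "a j = 0"
    using add unfolding monoid_addition_property_def by fastforce
  have "x * of_nat (a i) \<ge> 0" "y * of_nat (b j) \<ge> 0"
    using nat[OF ij(1)] nat[OF ij(2)] ij by (auto dest: Nats_imp_ge_0)
  then show "x \<in> \<nat> \<and> y \<in> \<nat>" using ints ij by (auto intro: rat_in_NatsI)
qed

text \<open>If the support of \<open>a\<close> were contained in that of \<open>b\<close>, then \<open>N b - a\<close> would be
  non-negative for large \<open>N\<close>.\<close>

lemma monoid_basis_on_imp_support_not_subset:
  assumes basis: "monoid_basis_on K a b" and K: "finite K"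
  shows "\<exists>k\<in>K. a k \<noteq> 0 \<and> b k = 0"
proof (rule ccontr)
  assume "\<not> ?thesis"
  then have sub: "b k > 0" if "k \<in> K" "a k > 0" for k using that by auto
  \<comment> \<open>Any common bound on the values of \<open>a\<close> over \<open>K\<close> would
    serve; the sum is one because \<open>K\<close> is finite.\<close>
  define N where "N = sum a K"
  have "(- 1) * of_nat (a k) + of_nat N * of_nat (b k) \<in> (\<nat> :: rat set)" if k: "k \<in> K" for k
  proof -
    have "a k \<le> N" unfolding N_def using K k by (intro member_le_sum) auto
    then have "a k \<le> N * b k" using sub[OF k]
      by (cases "a k = 0") (auto intro: order_trans[of _ N])
    then have "(- 1) * of_nat (a k) + of_nat N * of_nat (b k) = (of_nat (N * b k - a k) :: rat)"
      by (simp add: of_nat_diff)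
    then show ?thesis by (metis of_nat_in_Nats)
  qed
  from monoid_basis_onD(1)[OF basis this] show False by (auto dest: Nats_imp_ge_0)
qed

text \<open>The condition is symmetric in the two rows, so neither support contains the other; this
  yields both subscripts.\<close>

lemma monoid_basis_on_imp_monoid_addition:
  assumes "monoid_basis_on {1..r} a b"
  shows "monoid_addition_property r a b"
proof -
  obtain i where "i \<in> {1..r}" "a i \<noteq> 0" "b i = 0"
    using monoid_basis_on_imp_support_not_subset[OF assms] by auto
  moreover obtain j where "j \<in> {1..r}" "b j \<noteq> 0" "a j = 0"
    using monoid_basis_on_imp_support_not_subset[OF monoid_basis_on_commute[OF assms]] by auto
  ultimately show ?thesis unfolding monoid_addition_property_def
    by (intro bexI[of _ i] bexI[of _ j]) auto
qed

text \<open>If a prime \<open>l\<close> divides all the minors, then the rows are linearly dependent modulo \<open>l\<close>;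
  dividing a dependency with coefficients in \<open>{0..<l}\<close> by \<open>l\<close> gives a forbidden combination.\<close>

lemma monoid_basis_on_imp_trivial_index:
  assumes basis: "monoid_basis_on {1..r} a b"
  shows "trivial_index_property r a b"
proof (rule ccontr)
  let ?D = "{int (a i) * int (b j) - int (a j) * int (b i) | i j. 1 \<le> i \<and> i < j \<and> j \<le> r}"
  assume "\<not> ?thesis"
  then have "Gcd ?D \<noteq> 1" by (simp add: trivial_index_property_def)
  then have "\<not> is_unit (Gcd ?D)" by simp
  then obtain l where l: "prime l" "l dvd Gcd ?D"
  proof (cases "Gcd ?D = 0")
    case True
    \<comment> \<open>Here all minors vanish or there are none, so any prime divides them
      all.\<close>
    have "prime (2 :: int)" by simp
    then show ?thesis by (rule that) (simp only: True dvd_0_right)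
  next
    case False
    with prime_divisor_exists \<open>\<not> is_unit (Gcd ?D)\<close> that show ?thesis by blast
  qed
  have l0: "l > 1" using l(1) by (simp add: prime_gt_1_int)
  have minors: "l dvd int (a i) * int (b j) - int (a j) * int (b i)"
    if ij: "i \<in> {1..r}" "j \<in> {1..r}" for i j
  proof -
    have lt: "l dvd int (a i) * int (b j) - int (a j) * int (b i)"
      if "i < j" "i \<in> {1..r}" "j \<in> {1..r}" for i j
      using that by (intro dvd_trans[OF l(2)] Gcd_dvd) auto
    consider "i < j" | "j < i" | "i = j" by linarith
    then show ?thesis
    proof cases
      case 2
      from lt[OF this ij(2,1)] show ?thesis by (metis minus_diff_eq dvd_minus_iff mult.commute)
    qed (use lt ij in auto)
  qed
  have contra: "s = 0 \<and> t = 0"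
    if st: "0 \<le> s" "s < l" "0 \<le> t" "t < l"
      and dvd: "\<And>k. k \<in> {1..r} \<Longrightarrow> l dvd s * int (a k) + t * int (b k)" for s t
  proof -
    have "(of_int s / of_int l) * of_nat (a k) + (of_int t / of_int l) * of_nat (b k) \<in> (\<nat> :: rat set)"
      if k: "k \<in> {1..r}" for k
    proof -
      obtain z where z: "s * int (a k) + t * int (b k) = l * z" using dvd[OF k] by (rule dvdE)
      have "0 \<le> l * z" unfolding z[symmetric] using st by simp
      then have "z \<ge> 0" using l0 by (simp add: zero_le_mult_iff)
      have "(of_int (s * int (a k) + t * int (b k)) :: rat) = of_int (l * z)" using z by simp
      then have "(of_int s / of_int l) * of_nat (a k) + (of_int t / of_int l) * of_nat (b k) = (of_int z :: rat)"
        using l0 by (simp add: field_simps)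
      then show ?thesis using \<open>z \<ge> 0\<close> by (simp add: Nats_altdef2)
    qed
    note N = monoid_basis_onD[OF basis this]
    have "s' = 0" if s': "of_int s' / of_int l \<in> (\<nat> :: rat set)" "0 \<le> s'" "s' < l" for s'
    proof -
      obtain n where "of_int s' / of_int l = (of_nat n :: rat)" using s'(1) by (auto elim: Nats_cases)
      then have "(of_int s' :: rat) = of_int (int n * l)" using l0 by (simp add: field_simps)
      then have "s' = int n * l" unfolding of_int_eq_iff .
      then have "l dvd s'" by simp
      then show "s' = 0" using s' zdvd_not_zless[of s' l] by linarith
    qed
    with N st show ?thesis by blast
  qed
  show False
  proof (cases "\<forall>k\<in>{1..r}. l dvd int (a k)")
    case True
    \<comment> \<open>The first row vanishes modulo \<open>l\<close>, so the coefficients 1 and 0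
      give a dependency.\<close>
    then show False using contra[of 1 0] l0 by auto
  next
    case False
    then obtain k where k: "k \<in> {1..r}" "\<not> l dvd int (a k)" by auto
    \<comment> \<open>With column \<open>k\<close> fixed, \<open>- b k\<close> and
      \<open>a k\<close> are the coefficients of a dependency modulo \<open>l\<close>, since column
      \<open>m\<close> then gives a minor. Reducing them modulo \<open>l\<close> brings them into
      the range of \<open>contra\<close>, and the second stays nonzero by the choice of
      \<open>k\<close>.\<close>
    have "l dvd ((- int (b k)) mod l) * int (a m) + (int (a k) mod l) * int (b m)" if "m \<in> {1..r}" for m
    proof -
      have "(((- int (b k)) mod l) * int (a m) + (int (a k) mod l) * int (b m)) mod l
          = ((- int (b k)) * int (a m) + int (a k) * int (b m)) mod l"
        by (intro mod_add_cong mod_mult_left_eq)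
      also have "\<dots> = 0" using minors[OF k(1) that] by (simp add: algebra_simps)
      finally show ?thesis by (simp add: dvd_eq_mod_eq_0)
    qed
    then have "int (a k) mod l = 0" using contra[of "(- int (b k)) mod l" "int (a k) mod l"] l0 by simp
    then show False using k by auto
  qed
qed

text \<open>Each coordinate involves only one of \<open>x\<close> and \<open>y\<close>, so the two
  coefficients can be treated separately: gcd 1 makes each an integer, and a nonzero entry fixes its
  sign. This serves coprime integers that are not proper powers.\<close>

lemma monoid_basis_on_if_disjoint_support:
  assumes disj: "\<And>k. k \<in> K \<Longrightarrow> a k = 0 \<or> b k = 0"
    and a: "Gcd (a ` K) = 1" and b: "Gcd (b ` K) = 1"
  shows "monoid_basis_on K a b"
proof (rule monoid_basis_onI)
  have *: "z \<in> \<nat>"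
    if z: "\<And>k. k \<in> K \<Longrightarrow> z * of_nat (c k) \<in> \<nat>" and c: "Gcd (c ` K) = 1" for z :: rat and c
  proof -
    have "Gcd (int ` c ` K) = 1" using c by (simp add: Gcd_int_eq)
    then have int: "z \<in> \<int>" by (rule rat_in_Ints_if_Gcd_eq_1) (use z in \<open>auto intro: Nats_imp_Ints\<close>)
    \<comment> \<open>A row that is zero or empty would have gcd 0.\<close>
    have "\<not> c ` K \<subseteq> {0}" using c Gcd_0_iff[of "c ` K"] by auto
    then obtain k where k: "k \<in> K" "c k \<noteq> 0" by auto
    from rat_in_NatsI[OF int Nats_imp_ge_0[OF z[OF k(1)]]] k(2) show ?thesis by simp
  qed
  fix x y :: rat
  assume nat: "\<And>k. k \<in> K \<Longrightarrow> x * of_nat (a k) + y * of_nat (b k) \<in> \<nat>"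
  have "x * of_nat (a k) \<in> \<nat> \<and> y * of_nat (b k) \<in> \<nat>" if "k \<in> K" for k
    using nat[OF that] disj[OF that] by auto
  then show "x \<in> \<nat> \<and> y \<in> \<nat>" using *[OF _ a] *[OF _ b] by blast
qed

section \<open>Exponent vectors of integers\<close>

lemma range_nth_prime: "range nth_prime = {p. prime p}"
  unfolding nth_prime_def using range_enumerate[OF primes_infinite] by simp

lemma lookup_exponents [simp]:
  "Poly_Mapping.lookup (exponents g) k = of_nat (multiplicity (nth_prime k) g)"
  by (rule exponents.rep_eq[THEN fun_cong])

lemma exponents_mult:
  assumes "u > 0" "v > 0"
  shows "exponents (u * v) = exponents u + exponents v"
  using assms by (intro poly_mapping_eqI)
    (simp add: Poly_Mapping.lookup_add prime_elem_multiplicity_mult_distrib prime_nth_prime)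

lemma exponents_power:
  assumes "u > 0"
  shows "exponents (u ^ i) = fscale (of_nat i) (exponents u)"
  using assms by (intro poly_mapping_eqI)
    (simp add: prime_elem_multiplicity_power_distrib prime_nth_prime)

lemma exponents_monomial:
  assumes "u > 0" "v > 0"
  shows "exponents (u ^ i * v ^ j)
    = fscale (of_nat i) (exponents u) + fscale (of_nat j) (exponents v)"
  using assms by (simp add: exponents_mult exponents_power)

text \<open>This is unique factorization, as every prime occurs among the values of
  \<open>nth_prime\<close>.\<close>

lemma exponents_inject:
  assumes "x > 0" "y > 0" "exponents x = exponents y"
  shows "x = y"
proof (rule multiplicity_eq_nat[OF assms(1,2)])
  fix p :: nat
  assume "prime p"
  then obtain k where "p = nth_prime k" using range_nth_prime by blast
  moreover have "Poly_Mapping.lookup (exponents x) k = Poly_Mapping.lookup (exponents y) k"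
    using assms by simp
  ultimately show "multiplicity p x = multiplicity p y" by simp
qed

lemma exponents_1 [simp]: "exponents (Suc 0) = 0"
  by (intro poly_mapping_eqI) simp

lemma exponents_neq_0:
  assumes "g > 1"
  shows "exponents g \<noteq> 0"
  using exponents_inject[of g 1] assms by auto

text \<open>Injectivity of \<open>p\<close> allows reindexing the product by the primes themselves,
  where unique factorization gives the exponents.\<close>

lemma multiplicity_prod_indexed:
  fixes p :: "'i \<Rightarrow> nat"
  assumes fin: "finite I" and primes: "\<And>i. i \<in> I \<Longrightarrow> prime (p i)" and inj: "inj_on p I"
    and q: "prime q"
  shows "multiplicity q (\<Prod>i\<in>I. p i ^ a i) = (if q \<in> p ` I then a (inv_into I p q) else 0)"
proof -
  have "(\<Prod>i\<in>I. p i ^ a i) = (\<Prod>i\<in>I. p i ^ a (inv_into I p (p i)))"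
    using inj by (intro prod.cong) simp_all
  also have "\<dots> = (\<Prod>x\<in>p ` I. x ^ a (inv_into I p x))"
    using inj by (simp add: prod.reindex)
  finally have eq: "(\<Prod>i\<in>I. p i ^ a i) = (\<Prod>x\<in>p ` I. x ^ a (inv_into I p x))" .
  have "\<And>x. x \<in> p ` I \<Longrightarrow> prime x" using primes by auto
  from multiplicity_prod_prime_powers[OF finite_imageI[OF fin] this q] show ?thesis
    unfolding eq .
qed

text \<open>The product of the prescribed prime powers over the finite support of \<open>f\<close>
  is the required integer; taking floors only converts the coordinates to type
  \<open>nat\<close>.\<close>

lemma exponents_surj:
  assumes "\<And>k. Poly_Mapping.lookup f k \<in> \<nat>"
  obtains g where "g > 0" "exponents g = f"
proof
  define c where "c k = nat \<lfloor>Poly_Mapping.lookup f k\<rfloor>" for k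
  have c: "Poly_Mapping.lookup f k = of_nat (c k)" for k
    using assms[of k] unfolding c_def by (auto elim: Nats_cases)
  define g where "g = (\<Prod>k\<in>Poly_Mapping.keys f. nth_prime k ^ c k)"
  show "g > 0" unfolding g_def by (intro prod_pos) (simp add: prime_gt_0_nat prime_nth_prime)
  show "exponents g = f"
  proof (rule poly_mapping_eqI)
    fix k
    have "inj_on nth_prime (Poly_Mapping.keys f)" using inj_nth_prime by (rule inj_on_subset) simp
    then have "multiplicity (nth_prime k) g = (if k \<in> Poly_Mapping.keys f then c k else 0)"
      unfolding g_def using inj_nth_prime
      by (subst multiplicity_prod_indexed) (auto simp: prime_nth_prime dest: injD)
    then show "Poly_Mapping.lookup (exponents g) k = Poly_Mapping.lookup f k"
      using c by (auto simp: in_keys_iff)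
  qed
qed

text \<open>Multiplying by the product of all denominators on the support makes the coordinates
  natural, so the multiple is the exponent vector of an integer.\<close>

lemma nonneg_multiple_of_exponents:
  assumes "\<And>k. 0 \<le> Poly_Mapping.lookup f k"
  obtains c g where "c \<noteq> 0" "g > 0" "f = fscale c (exponents g)"
proof -
  define N where "N = (\<Prod>k\<in>Poly_Mapping.keys f. snd (quotient_of (Poly_Mapping.lookup f k)))"
  have N: "N > 0" unfolding N_def by (intro prod_pos) (simp add: quotient_of_denom_pos')
  have "Poly_Mapping.lookup (fscale (of_int N) f) k \<in> \<nat>" for k
  proof (cases "k \<in> Poly_Mapping.keys f")
    case True
    obtain m n where q: "quotient_of (Poly_Mapping.lookup f k) = (m, n)" by fastforce
    have "n dvd N" unfolding N_def using True q
      by (intro dvd_trans[OF _ dvd_prodI[of _ k]]) auto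
    then obtain z where z: "N = n * z" by (rule dvdE)
    have "n > 0" using quotient_of_denom_pos[OF q] .
    then have "of_int N * Poly_Mapping.lookup f k = of_int (z * m)"
      using quotient_of_div[OF q] by (simp add: z)
    moreover have "0 \<le> of_int N * Poly_Mapping.lookup f k" using N assms by simp
    ultimately show ?thesis by (simp add: Nats_altdef2)
  qed (simp add: in_keys_iff)
  then obtain g where "g > 0" "exponents g = fscale (of_int N) f" by (rule exponents_surj)
  moreover from this have "f = fscale (1 / of_int N) (exponents g)"
    using N by (simp add: finseq.scale_scale)
  ultimately show ?thesis using N by (intro that[of "1 / of_int N" g]) auto
qed

section \<open>Planes spanned by two vectors\<close>

lemma span_pair_iff: "f \<in> finseq.span {v, w} \<longleftrightarrow> (\<exists>x y. f = fscale x v + fscale y w)"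
proof -
  have "f \<in> finseq.span {v, w} \<longleftrightarrow> (\<exists>x y. f - fscale x v = fscale y w)"
    unfolding finseq.span_breakdown_eq[of f v] finseq.span_singleton by auto
  then show ?thesis by (simp add: algebra_simps)
qed

text \<open>That \<open>v\<close> and \<open>w\<close> differ is a separate conclusion because the
  set \<open>{v, w}\<close> collapses to a singleton when they coincide, and may then still be
  independent.\<close>

lemma independent_pairI:
  assumes "\<And>x y. fscale x v + fscale y w = 0 \<Longrightarrow> x = 0 \<and> y = 0"
  shows "v \<noteq> w" "finseq.independent {v, w}"
proof -
  have w: "w \<noteq> 0" using assms[of 0 1] by auto
  have "v \<notin> finseq.span {w}"
  proof
    assume "v \<in> finseq.span {w}"
    then obtain c where "v = fscale c w" by (auto simp: finseq.span_singleton)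
    then show False using assms[of 1 "- c"] by simp
  qed
  then show "v \<noteq> w" "finseq.independent {v, w}"
    using w by (auto simp: finseq.independent_insert finseq.span_base)
qed

lemma independent_pair_not_in_span_singleton:
  assumes "v \<noteq> w" "finseq.independent {v, w}"
  shows "\<not> {v, w} \<subseteq> finseq.span {z}"
  using finseq.independent_span_bound[of "{z}" "{v, w}"] assms by auto

text \<open>A vector of the larger span outside the smaller one would give three independent vectors
  in a span of two.\<close>

lemma span_pair_eqI:
  assumes "a \<noteq> b" "finseq.independent {a, b}" "a \<in> finseq.span {v, w}" "b \<in> finseq.span {v, w}"
  shows "finseq.span {v, w} = finseq.span {a, b}"
proof
  have "z \<in> finseq.span {a, b}" if z: "z \<in> finseq.span {v, w}" for z
  proof (rule ccontr)
    assume *: "z \<notin> finseq.span {a, b}"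
    then have "z \<notin> {a, b}" by (auto intro: finseq.span_base)
    moreover have "finseq.independent {z, a, b}" using * assms(2) by (rule finseq.independent_insertI)
    ultimately have "3 \<le> card {v, w}"
      using finseq.independent_span_bound[of "{v, w}" "{z, a, b}"] assms z by auto
    moreover have "card {v, w} \<le> 2" by (simp add: card_insert_if)
    ultimately show False by simp
  qed
  then show "finseq.span {v, w} \<subseteq> finseq.span {a, b}" by blast
  show "finseq.span {a, b} \<subseteq> finseq.span {v, w}"
    using assms by (intro finseq.span_minimal) auto
qed

section \<open>Projective classes and lines\<close>

lemma proj_class_eq_iff:
  assumes "v \<noteq> 0" "w \<noteq> 0"
  shows "proj_rel `` {v} = proj_rel `` {w} \<longleftrightarrow> (\<exists>c. w = fscale c v)"
  using eq_equiv_class_iff[OF equiv_proj_rel, of v w] assms by (auto simp: proj_rel_def)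

lemma proj_class_in_PF: "v \<noteq> 0 \<Longrightarrow> proj_rel `` {v} \<in> PF"
  unfolding PF_def by (intro quotientI) simp

lemma mem_proj_class: "v \<noteq> 0 \<Longrightarrow> v \<in> proj_rel `` {v}"
  by (auto simp: proj_rel_def intro!: exI[of _ 1])

text \<open>Other representatives of the three classes differ by nonzero factors, which the span
  absorbs.\<close>

lemma proj_class_in_line_iff:
  assumes "v \<noteq> 0" "w \<noteq> 0" "x \<noteq> 0"
  shows "proj_rel `` {x} \<in> proj_line (proj_rel `` {v}) (proj_rel `` {w})
    \<longleftrightarrow> x \<in> finseq.span {v, w}"
proof
  assume "x \<in> finseq.span {v, w}"
  then show "proj_rel `` {x} \<in> proj_line (proj_rel `` {v}) (proj_rel `` {w})"
    unfolding proj_line_def using assms mem_proj_class proj_class_in_PF by blast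
next
  assume "proj_rel `` {x} \<in> proj_line (proj_rel `` {v}) (proj_rel `` {w})"
  then obtain c d e where e: "e \<noteq> 0"
    and *: "fscale e x \<in> finseq.span {fscale c v, fscale d w}"
    unfolding proj_line_def by (auto simp: proj_rel_def)
  have "finseq.span {fscale c v, fscale d w} \<subseteq> finseq.span {v, w}"
    by (intro finseq.span_minimal) (auto intro: finseq.span_scale finseq.span_base)
  then have "fscale (1 / e) (fscale e x) \<in> finseq.span {v, w}"
    using * by (intro finseq.span_scale[of "fscale e x"]) (rule subsetD)
  then show "x \<in> finseq.span {v, w}" using e by (simp add: finseq.scale_scale)
qed

text \<open>The class is generated by any of its members, in particular by a non-negative
  one.\<close>

lemma PF_nonneg_rep:
  assumes "P \<in> PF_nonneg"
  obtains v where "v \<noteq> 0" "P = proj_rel `` {v}" "\<And>i. 0 \<le> Poly_Mapping.lookup v i"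
proof -
  obtain v where v: "v \<in> P" "\<And>i. 0 \<le> Poly_Mapping.lookup v i" and "P \<in> {v. v \<noteq> 0} // proj_rel"
    using assms by (auto simp: PF_nonneg_def PF_def)
  then obtain x where x: "P = proj_rel `` {x}" by (auto elim: quotientE)
  with v have "(x, v) \<in> proj_rel" by simp
  then have "v \<noteq> 0" "P = proj_rel `` {v}"
    using x equiv_class_eq[OF equiv_proj_rel] by (auto simp: proj_rel_def)
  then show ?thesis by (rule that) (rule v(2))
qed

lemma int_point_in_PF_nonneg: "g > 1 \<Longrightarrow> int_point g \<in> PF_nonneg"
  unfolding PF_nonneg_def int_point_def
  using proj_class_in_PF[OF exponents_neq_0] mem_proj_class[OF exponents_neq_0]
  by (intro CollectI conjI bexI[of _ "exponents g"]) simp_all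

text \<open>The exponent vector of 1 is zero and lies in every span, so the separately adjoined 1
  fits the uniform description.\<close>

lemma assoc_integers_line:
  assumes "v \<noteq> 0" "w \<noteq> 0"
  shows "assoc_integers (proj_line (proj_rel `` {v}) (proj_rel `` {w}))
    = {g. g > 0 \<and> exponents g \<in> finseq.span {v, w}}"
proof -
  have "int_point g \<in> proj_line (proj_rel `` {v}) (proj_rel `` {w})
      \<longleftrightarrow> exponents g \<in> finseq.span {v, w}" if "g > 1" for g
    unfolding int_point_def using that assms exponents_neq_0 by (intro proj_class_in_line_iff)
  moreover have "g > 0 \<longleftrightarrow> g = 1 \<or> g > 1" for g :: nat by auto
  ultimately show ?thesis
    unfolding assoc_integers_def using finseq.span_zero by auto
qed

section \<open>Multiplicative bases of the integers on a line\<close>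

text \<open>Indexing by the primes themselves makes the comparison with arbitrary products of prime
  powers direct; \<open>monoid_basis_iff\<close> passes to the coordinates of exponent
  vectors.\<close>

definition monoid_basis :: "nat \<Rightarrow> nat \<Rightarrow> bool" where
  "monoid_basis u v \<longleftrightarrow> monoid_basis_on {p. prime p} (\<lambda>p. multiplicity p u) (\<lambda>p. multiplicity p v)"

lemma monoid_basis_iff:
  "monoid_basis u v \<longleftrightarrow>
    (\<forall>x y. (\<forall>k. Poly_Mapping.lookup (fscale x (exponents u) + fscale y (exponents v)) k \<in> \<nat>)
      \<longrightarrow> x \<in> \<nat> \<and> y \<in> \<nat>)"
  unfolding monoid_basis_def monoid_basis_on_def range_nth_prime[symmetric]
  by (simp add: Poly_Mapping.lookup_add)

text \<open>A linear relation may be scaled by any rational \<open>t\<close>, so all multiples of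
  its coefficients are natural; a nonzero coefficient has -1 among its multiples.\<close>

lemma monoid_basis_imp_independent:
  assumes "monoid_basis u v"
  shows "exponents u \<noteq> exponents v" "finseq.independent {exponents u, exponents v}"
proof -
  have "x = 0 \<and> y = 0" if 0: "fscale x (exponents u) + fscale y (exponents v) = 0" for x y
  proof -
    have "fscale (t * x) (exponents u) + fscale (t * y) (exponents v) = 0" for t
      using arg_cong[OF 0, of "fscale t"] by (simp add: finseq.scale_right_distrib)
    then have nat: "t * x \<in> \<nat> \<and> t * y \<in> \<nat>" for t
      using assms unfolding monoid_basis_iff by (metis Nats_0 lookup_zero)
    have "z = 0" if "\<And>t :: rat. t * z \<in> \<nat>" for z :: rat
    proof (rule ccontr)
      assume "z \<noteq> 0"
      then show False using Nats_imp_ge_0[OF that[of "- 1 / z"]] by simp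
    qed
    then show ?thesis using nat by blast
  qed
  from independent_pairI[OF this]
  show "exponents u \<noteq> exponents v" "finseq.independent {exponents u, exponents v}" by blast+
qed

text \<open>By independence the exponent vectors of \<open>u\<close> and \<open>v\<close> span the
  whole plane. An exponent vector in it has natural entries, so its coefficients are natural, and
  they are the powers of \<open>u\<close> and \<open>v\<close>.\<close>

lemma monoid_basis_imp_generated:
  assumes basis: "monoid_basis u v" and pos: "u > 0" "v > 0"
    and span: "exponents u \<in> finseq.span {x, y}" "exponents v \<in> finseq.span {x, y}"
  shows "{g. g > 0 \<and> exponents g \<in> finseq.span {x, y}} = {u ^ i * v ^ j | i j. True}"
proof -
  note eq = span_pair_eqI[OF monoid_basis_imp_independent[OF basis] span]
  have "\<exists>i j. g = u ^ i * v ^ j" if g: "g > 0" "exponents g \<in> finseq.span {x, y}" for g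
  proof -
    obtain s t where st: "exponents g = fscale s (exponents u) + fscale t (exponents v)"
      using g(2) unfolding eq span_pair_iff by blast
    have "s \<in> \<nat> \<and> t \<in> \<nat>"
      using basis unfolding monoid_basis_iff st[symmetric] by (metis st lookup_exponents of_nat_in_Nats)
    then obtain i j where "s = of_nat i" "t = of_nat j" by (metis Nats_cases)
    then have "exponents g = exponents (u ^ i * v ^ j)" using st pos by (simp add: exponents_monomial)
    then show ?thesis using exponents_inject[of g "u ^ i * v ^ j"] g(1) pos by auto
  qed
  moreover have "exponents (u ^ i * v ^ j) \<in> finseq.span {x, y}" for i j
    unfolding exponents_monomial[OF pos] eq span_pair_iff by blast
  ultimately show ?thesis using pos by auto
qed

lemma generators_in_monoid:
  fixes u v :: nat
  shows "u \<in> {u ^ i * v ^ j | i j. True}" "v \<in> {u ^ i * v ^ j | i j. True}"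
proof -
  have "u = u ^ 1 * v ^ 0" "v = u ^ 0 * v ^ 1" by simp_all
  then show "u \<in> {u ^ i * v ^ j | i j. True}" "v \<in> {u ^ i * v ^ j | i j. True}" by blast+
qed

text \<open>A combination with natural entries is the exponent vector of an integer on the line,
  hence of a monomial in \<open>u\<close> and \<open>v\<close>. Comparing coefficients then requires
  independence, which follows because these exponent vectors span the plane.\<close>

lemma generated_imp_monoid_basis:
  assumes ind: "x \<noteq> y" "finseq.independent {x, y}"
    and nonneg: "\<And>k. 0 \<le> Poly_Mapping.lookup x k" "\<And>k. 0 \<le> Poly_Mapping.lookup y k"
    and pos: "u > 0" "v > 0"
    and gen: "{g. g > 0 \<and> exponents g \<in> finseq.span {x, y}} = {u ^ i * v ^ j | i j. True}"
  shows "monoid_basis u v"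
proof -
  \<comment> \<open>Being non-negative, \<open>x\<close> and \<open>y\<close> are multiples of
    exponent vectors of integers on the line, which are monomials in \<open>u\<close> and
    \<open>v\<close>.\<close>
  have sub: "z \<in> finseq.span {exponents u, exponents v}"
    if z: "z \<in> {x, y}" for z
  proof -
    obtain c g where cg: "c \<noteq> 0" "g > 0" "z = fscale c (exponents g)"
      using nonneg_multiple_of_exponents[of z] nonneg z by blast
    have "fscale (1 / c) z \<in> finseq.span {x, y}" using z by (intro finseq.span_scale finseq.span_base)
    then have "exponents g \<in> finseq.span {x, y}" using cg by (simp add: finseq.scale_scale)
    then obtain i j where "g = u ^ i * v ^ j" using gen cg(2) by blast
    then have "exponents g \<in> finseq.span {exponents u, exponents v}"
      unfolding span_pair_iff using exponents_monomial[OF pos] by blast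
    then show ?thesis unfolding cg(3) by (rule finseq.span_scale)
  qed
  have zero: "s = 0 \<and> t = 0" if st: "fscale s (exponents u) + fscale t (exponents v) = 0" for s t
  proof -
    \<comment> \<open>A relation with a nonzero coefficient would squeeze \<open>x\<close> and
      \<open>y\<close> into the span of one vector. Stating this for \<open>a\<close> and
      \<open>b\<close> covers both orders of \<open>u\<close> and \<open>v\<close>.\<close>
    have coll: False
      if c: "c \<noteq> 0" "fscale c a + fscale d b = 0" "{a, b} = {exponents u, exponents v}"
      for a b c d
    proof -
      have "fscale (1 / c) (fscale c a + fscale d b) = 0" using c(2) by simp
      then have "a = fscale (- d / c) b" using c(1)
        by (simp add: finseq.scale_right_distrib finseq.scale_scale eq_neg_iff_add_eq_0)
      then have "a \<in> finseq.span {b}" unfolding finseq.span_singleton by (rule range_eqI)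
      then have "finseq.span {a, b} \<subseteq> finseq.span {b}"
        by (intro finseq.span_minimal) (auto intro: finseq.span_base)
      then have "{x, y} \<subseteq> finseq.span {b}"
        unfolding c(3) using sub by (meson subset_iff)
      then show False by (rule notE[OF independent_pair_not_in_span_singleton[OF ind]])
    qed
    have "fscale t (exponents v) + fscale s (exponents u) = 0"
      using st by (simp only: add.commute)
    with coll[OF _ st refl] coll[OF _ this insert_commute] show ?thesis by blast
  qed
  have uv: "exponents u \<in> finseq.span {x, y}" "exponents v \<in> finseq.span {x, y}"
  proof -
    have "u \<in> {g. g > 0 \<and> exponents g \<in> finseq.span {x, y}}"
      "v \<in> {g. g > 0 \<and> exponents g \<in> finseq.span {x, y}}"
      unfolding gen by (rule generators_in_monoid)+
    then show "exponents u \<in> finseq.span {x, y}" "exponents v \<in> finseq.span {x, y}" by simp_all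
  qed
  show ?thesis unfolding monoid_basis_iff
  proof (intro allI impI)
    fix s t
    assume nat: "\<forall>k. Poly_Mapping.lookup (fscale s (exponents u) + fscale t (exponents v)) k \<in> \<nat>"
    then obtain g where g: "g > 0" "exponents g = fscale s (exponents u) + fscale t (exponents v)"
      using exponents_surj by blast
    have "exponents g \<in> finseq.span {x, y}"
      unfolding g(2) using uv by (intro finseq.span_add finseq.span_scale)
    then obtain i j where "g = u ^ i * v ^ j" using gen g(1) by blast
    then have "fscale s (exponents u) + fscale t (exponents v)
        = fscale (of_nat i) (exponents u) + fscale (of_nat j) (exponents v)"
      using g(2) exponents_monomial[OF pos] by simp
    then have "fscale (s - of_nat i) (exponents u) + fscale (t - of_nat j) (exponents v) = 0"
      by (simp add: finseq.scale_left_diff_distrib algebra_simps)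
    from zero[OF this] have "s = of_nat i" "t = of_nat j" by simp_all
    then show "s \<in> \<nat> \<and> t \<in> \<nat>" by simp
  qed
qed

section \<open>Prime factorizations and perfect powers\<close>

lemma monoid_basis_prod_iff:
  fixes p :: "'i \<Rightarrow> nat"
  assumes fin: "finite I" and primes: "\<And>i. i \<in> I \<Longrightarrow> prime (p i)" and inj: "inj_on p I"
  shows "monoid_basis (\<Prod>i\<in>I. p i ^ a i) (\<Prod>i\<in>I. p i ^ b i) \<longleftrightarrow> monoid_basis_on I a b"
proof -
  have "(\<forall>q\<in>{p. prime p}. x * of_nat (multiplicity q (\<Prod>i\<in>I. p i ^ a i))
        + y * of_nat (multiplicity q (\<Prod>i\<in>I. p i ^ b i)) \<in> \<nat>)
      \<longleftrightarrow> (\<forall>i\<in>I. x * of_nat (a i) + y * of_nat (b i) \<in> \<nat>)" for x y :: rat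
    using primes inj by (auto simp: multiplicity_prod_indexed[OF fin primes inj])
  then show ?thesis unfolding monoid_basis_def monoid_basis_on_def by simp
qed

text \<open>The extra primes contribute factors 1. This lets two integers be written over a common
  list of primes.\<close>

lemma nat_eq_prod_primes_superset:
  fixes n :: nat
  assumes "n > 0" "finite F" "prime_factors n \<subseteq> F" "\<And>q. q \<in> F \<Longrightarrow> prime q"
  shows "n = (\<Prod>q\<in>F. q ^ multiplicity q n)"
proof -
  have "n = (\<Prod>q\<in>prime_factors n. q ^ multiplicity q n)" using assms(1) by (rule prime_factorization_nat)
  also have "\<dots> = (\<Prod>q\<in>F. q ^ multiplicity q n)"
    using assms by (intro prod.mono_neutral_left) (auto simp: prime_factors_multiplicity)
  finally show ?thesis .
qed

text \<open>Take for \<open>d\<close> the gcd of all prime exponents of \<open>g\<close>; the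
  exponents of the \<open>d\<close>-th root then have gcd 1.\<close>

lemma primitive_root_exists:
  fixes g :: nat
  assumes "g > 1"
  obtains h d where "h > 1" "d > 0" "g = h ^ d" "Gcd ((\<lambda>p. multiplicity p h) ` {p. prime p}) = 1"
proof -
  define d where "d = Gcd ((\<lambda>p. multiplicity p g) ` {p. prime p})"
  \<comment> \<open>A prime divisor of \<open>g\<close> has a positive exponent, so the gcd
    \<open>d\<close> is not 0.\<close>
  obtain q where q: "prime q" "q dvd g" using assms by (metis less_irrefl prime_factor_nat)
  then have "multiplicity q g > 0" using assms by (simp add: prime_multiplicity_gt_zero_iff)
  moreover have "d dvd multiplicity q g" unfolding d_def using q by (intro Gcd_dvd) simp
  ultimately have d: "d > 0" by (metis dvd_0_left_iff neq0_conv)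
  have "d dvd multiplicity p g" if "prime p" for p unfolding d_def using that by (intro Gcd_dvd) simp
  then have "is_nth_power d g" using is_nth_power_conv_multiplicity_nat[OF d] by blast
  then obtain h where h: "g = h ^ d" by (auto elim: is_nth_powerE)
  have "h \<noteq> 0"
  proof
    assume "h = 0"
    then show False using h assms d by (simp add: zero_power)
  qed
  moreover have "h \<noteq> 1" using h assms by auto
  ultimately have h1: "h > 1" by simp
  have "(\<lambda>p. multiplicity p g) ` {p. prime p} = (*) d ` (\<lambda>p. multiplicity p h) ` {p. prime p}"
    unfolding h image_image using h1
    by (intro image_cong) (auto simp: prime_elem_multiplicity_power_distrib)
  then have "Gcd ((\<lambda>p. multiplicity p g) ` {p. prime p}) = d * Gcd ((\<lambda>p. multiplicity p h) ` {p. prime p})"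
    by (simp only: Gcd_mult normalize_nat_def id_apply)
  with d_def have "d = d * Gcd ((\<lambda>p. multiplicity p h) ` {p. prime p})" by (rule trans)
  then show ?thesis using that[OF h1 d h] d by simp
qed

section \<open>Criteria for doubly multiplicatively closed lines\<close>

lemma doubly_generated_line:
  assumes "x \<noteq> 0" "y \<noteq> 0" "u > 1" "v > 1" "monoid_basis u v"
    and "exponents u \<in> finseq.span {x, y}" "exponents v \<in> finseq.span {x, y}"
  shows "doubly_generated (assoc_integers (proj_line (proj_rel `` {x}) (proj_rel `` {y})))"
proof -
  have "{g. g > 0 \<and> exponents g \<in> finseq.span {x, y}} = {u ^ i * v ^ j | i j. True}"
    using assms by (intro monoid_basis_imp_generated) auto
  then show ?thesis
    unfolding assoc_integers_line[OF assms(1,2)] doubly_generated_def using assms(3,4) by blast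
qed

theorem theorem7p12:
  fixes L :: "(nat \<Rightarrow>\<^sub>0 rat) set set" and P1 P2 :: "(nat \<Rightarrow>\<^sub>0 rat) set"
  assumes "P1 \<in> PF_nonneg" and "P2 \<in> PF_nonneg" and "P1 \<noteq> P2"
    and "L = proj_line P1 P2"
  shows "(doubly_mult_closed_line L \<longleftrightarrow>
           (\<exists>Q1\<in>L \<inter> PF_nonneg. \<exists>Q2\<in>L \<inter> PF_nonneg. Q1 \<noteq> Q2 \<and>
             (\<exists>(q1::nat) (q2::nat) (r::nat) (p::nat \<Rightarrow> nat) (a::nat \<Rightarrow> nat) (b::nat \<Rightarrow> nat).
                q1 > 1 \<and> q2 > 1 \<and> Q1 = int_point q1 \<and> Q2 = int_point q2 \<and>
                (\<forall>i\<in>{1..r}. prime (p i)) \<and> inj_on p {1..r} \<and>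
                q1 = (\<Prod>i=1..r. p i ^ a i) \<and> q2 = (\<Prod>i=1..r. p i ^ b i) \<and>
                trivial_index_property r a b \<and> monoid_addition_property r a b))) \<and>
         ((\<exists>Q1\<in>L \<inter> PF_nonneg. \<exists>Q2\<in>L \<inter> PF_nonneg. Q1 \<noteq> Q2 \<and>
             (\<exists>(q1::nat) (q2::nat). q1 > 1 \<and> q2 > 1 \<and> Q1 = int_point q1 \<and> Q2 = int_point q2 \<and>
                coprime q1 q2)) \<longrightarrow>
           doubly_mult_closed_line L)"
proof -
  obtain x where x: "x \<noteq> 0" "P1 = proj_rel `` {x}" "\<And>i. 0 \<le> Poly_Mapping.lookup x i"
    using assms(1) by (rule PF_nonneg_rep) blast
  obtain y where y: "y \<noteq> 0" "P2 = proj_rel `` {y}" "\<And>i. 0 \<le> Poly_Mapping.lookup y i"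
    using assms(2) by (rule PF_nonneg_rep) blast
  have L: "L = proj_line (proj_rel `` {x}) (proj_rel `` {y})" using assms(4) x y by simp
  \<comment> \<open>Proportional representatives would make the two points equal.\<close>
  have "x \<notin> finseq.span {y}"
  proof
    assume "x \<in> finseq.span {y}"
    then have "\<exists>c. x = fscale c y" by (auto simp: finseq.span_singleton)
    then show False using proj_class_eq_iff[OF y(1) x(1)] x(2) y(2) assms(3) by simp
  qed
  then have ind: "x \<noteq> y" "finseq.independent {x, y}"
    using y(1) by (auto simp: finseq.independent_insert finseq.span_base)
  have on_line: "int_point g \<in> L \<longleftrightarrow> exponents g \<in> finseq.span {x, y}" if "g > 1" for g
    unfolding L int_point_def using that x y exponents_neq_0 by (intro proj_class_in_line_iff)
  \<comment> \<open>Both sufficient conditions reduce to finding such a pair \<open>u\<close>,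
    \<open>v\<close>.\<close>
  have closed: "doubly_mult_closed_line L"
    if uv: "u > 1" "v > 1" "monoid_basis u v"
      "exponents u \<in> finseq.span {x, y}" "exponents v \<in> finseq.span {x, y}"
    for u v
    unfolding doubly_mult_closed_line_def
    using doubly_generated_line[OF x(1) y(1) uv] assms(1-3) unfolding L x(2) y(2)
    by (intro conjI bexI[of _ "proj_rel `` {x}"] bexI[of _ "proj_rel `` {y}"]) simp_all
  show ?thesis
  proof (intro conjI iffI impI; (elim bexE conjE exE)?)
    assume "doubly_mult_closed_line L"
    then obtain u v where uv: "u > 1" "v > 1" and gen: "assoc_integers L = {u ^ i * v ^ j | i j. True}"
      unfolding doubly_mult_closed_line_def doubly_generated_def by blast
    have basis: "monoid_basis u v"
      using gen uv x y unfolding L assoc_integers_line[OF x(1) y(1)]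
      by (intro generated_imp_monoid_basis[OF ind]) auto
    have "u \<in> assoc_integers L" "v \<in> assoc_integers L"
      unfolding gen by (rule generators_in_monoid)+
    then have mem: "int_point u \<in> L \<inter> PF_nonneg" "int_point v \<in> L \<inter> PF_nonneg"
      using uv int_point_in_PF_nonneg unfolding assoc_integers_def by auto
    have neq: "int_point u \<noteq> int_point v"
    proof
      assume "int_point u = int_point v"
      then obtain c where "exponents v = fscale c (exponents u)"
        unfolding int_point_def using proj_class_eq_iff exponents_neq_0 uv by blast
      then have "{exponents u, exponents v} \<subseteq> finseq.span {exponents u}"
        by (auto intro: finseq.span_scale finseq.span_base)
      then show False
        by (rule notE[OF independent_pair_not_in_span_singleton[OF monoid_basis_imp_independent[OF basis]]])
    qed
    \<comment> \<open>The columns of the matrix are the primes dividing \<open>u\<close> or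
      \<open>v\<close>, numbered from 1 to \<open>card F\<close>; its rows are their
      multiplicities.\<close>
    define F where "F = prime_factors u \<union> prime_factors v"
    have F: "finite F" "\<And>q. q \<in> F \<Longrightarrow> prime q" by (auto simp: F_def)
    obtain p where p: "bij_betw p {1..card F} F" using ex_bij_betw_nat_finite_1[OF F(1)] by blast
    have prod: "n = (\<Prod>i=1..card F. p i ^ multiplicity (p i) n)" if "n > 0" "prime_factors n \<subseteq> F" for n
      unfolding prod.reindex_bij_betw[OF p, of "\<lambda>q. q ^ multiplicity q n"]
      using that F by (intro nat_eq_prod_primes_superset)
    have u_prod: "u = (\<Prod>i=1..card F. p i ^ multiplicity (p i) u)"
      using uv by (intro prod) (auto simp: F_def)
    have v_prod: "v = (\<Prod>i=1..card F. p i ^ multiplicity (p i) v)"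
      using uv by (intro prod) (auto simp: F_def)
    have pF: "\<forall>i\<in>{1..card F}. prime (p i)" "inj_on p {1..card F}"
      using p F by (auto simp: bij_betw_def)
    have "monoid_basis (\<Prod>i=1..card F. p i ^ multiplicity (p i) u)
        (\<Prod>i=1..card F. p i ^ multiplicity (p i) v)"
      unfolding u_prod[symmetric] v_prod[symmetric] by (rule basis)
    then have on: "monoid_basis_on {1..card F} (\<lambda>i. multiplicity (p i) u) (\<lambda>i. multiplicity (p i) v)"
      using monoid_basis_prod_iff[of "{1..card F}" p] pF by simp
    have "trivial_index_property (card F) (\<lambda>i. multiplicity (p i) u) (\<lambda>i. multiplicity (p i) v)"
      "monoid_addition_property (card F) (\<lambda>i. multiplicity (p i) u) (\<lambda>i. multiplicity (p i) v)"
      using monoid_basis_on_imp_trivial_index[OF on] monoid_basis_on_imp_monoid_addition[OF on] by blast+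
    show "\<exists>Q1\<in>L \<inter> PF_nonneg. \<exists>Q2\<in>L \<inter> PF_nonneg. Q1 \<noteq> Q2 \<and>
             (\<exists>(q1::nat) (q2::nat) (r::nat) (p::nat \<Rightarrow> nat) (a::nat \<Rightarrow> nat) (b::nat \<Rightarrow> nat).
                q1 > 1 \<and> q2 > 1 \<and> Q1 = int_point q1 \<and> Q2 = int_point q2 \<and>
                (\<forall>i\<in>{1..r}. prime (p i)) \<and> inj_on p {1..r} \<and>
                q1 = (\<Prod>i=1..r. p i ^ a i) \<and> q2 = (\<Prod>i=1..r. p i ^ b i) \<and>
                trivial_index_property r a b \<and> monoid_addition_property r a b)"
      by (intro bexI[of _ "int_point u", OF _ mem(1)] bexI[of _ "int_point v", OF _ mem(2)])
        (rule conjI[OF neq], rule exI[of _ u], rule exI[of _ v], rule exI[of _ "card F"],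
          rule exI[of _ p], rule exI[of _ "\<lambda>i. multiplicity (p i) u"],
          rule exI[of _ "\<lambda>i. multiplicity (p i) v"], intro conjI refl; fact)
  next
    fix Q1 Q2 q1 q2 r and p a b :: "nat \<Rightarrow> nat"
    assume Q: "Q1 \<in> L \<inter> PF_nonneg" "Q2 \<in> L \<inter> PF_nonneg" "Q1 = int_point q1" "Q2 = int_point q2"
      and q: "q1 > 1" "q2 > 1"
      and p: "\<forall>i\<in>{1..r}. prime (p i)" "inj_on p {1..r}"
      and prod: "q1 = (\<Prod>i=1..r. p i ^ a i)" "q2 = (\<Prod>i=1..r. p i ^ b i)"
      and props: "trivial_index_property r a b" "monoid_addition_property r a b"
    have basis: "monoid_basis q1 q2"
      using monoid_basis_prod_iff[of "{1..r}" p a b] p prod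
        monoid_basis_on_if_index_and_addition[OF props] by simp
    show "doubly_mult_closed_line L"
      using on_line[OF q(1)] on_line[OF q(2)] Q by (intro closed[OF q basis]) simp_all
  next
    fix Q1 Q2 and q1 q2 :: nat
    assume Q: "Q1 \<in> L \<inter> PF_nonneg" "Q2 \<in> L \<inter> PF_nonneg" "Q1 = int_point q1" "Q2 = int_point q2"
      and q: "q1 > 1" "q2 > 1" and cop: "coprime q1 q2"
    obtain u m where u: "u > 1" "m > 0" "q1 = u ^ m" "Gcd ((\<lambda>p. multiplicity p u) ` {p. prime p}) = 1"
      using q(1) by (rule primitive_root_exists)
    obtain v n where v: "v > 1" "n > 0" "q2 = v ^ n" "Gcd ((\<lambda>p. multiplicity p v) ` {p. prime p}) = 1"
      using q(2) by (rule primitive_root_exists)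
    \<comment> \<open>The exponents \<open>m\<close> and \<open>n\<close> are positive, so
      coprimality passes to the bases.\<close>
    have "coprime u v" using cop u v by simp
    then have "multiplicity p u = 0 \<or> multiplicity p v = 0" if "prime p" for p
      using that by (metis coprime_common_divisor not_dvd_imp_multiplicity_0 not_prime_unit)
    then have basis: "monoid_basis u v"
      unfolding monoid_basis_def using u v by (intro monoid_basis_on_if_disjoint_support) auto
    \<comment> \<open>Taking a root only rescales the exponent vector, so \<open>u\<close> and
      \<open>v\<close> stay on the line.\<close>
    have root: "exponents h \<in> finseq.span {x, y}"
      if h: "h > 1" "d > 0" "exponents (h ^ d) \<in> finseq.span {x, y}" for h d :: nat
    proof -
      have "fscale (1 / of_nat d) (exponents (h ^ d)) \<in> finseq.span {x, y}"
        using h(3) by (rule finseq.span_scale)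
      then show ?thesis using h(1,2) by (simp add: exponents_power finseq.scale_scale)
    qed
    show "doubly_mult_closed_line L"
      using on_line[OF q(1)] on_line[OF q(2)] Q u(3) v(3)
      by (intro closed[OF u(1) v(1) basis] root[OF u(1,2)] root[OF v(1,2)]) simp_all
  qed
qed

end
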